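(* Let $G$ be a finite abelian group and let $F \subseteq \mathcal C(G)$ be a face of the group cone, with Kunz subgroup $H$ and Kunz poset $P=(G/H,\preceq)$. Define a commutative operation $\oplus$ on the set $N=(G/H)\cup\{\infty\}$ by declaring $\infty\oplus u=u\oplus\infty=\infty$ for all $u\in N$, and, for $a,b\in G$, \[ \overline a\oplus\overline b=\begin{cases}\overline a+\overline b & \text{if } x_a+x_b=x_{a+b}\text{ for all } x\in F,\\ \infty & \text{otherwise.}\end{cases} \] Then $(N,\oplus)$ is a partly cancellative nilsemigroup with identity (called the Kunz nilsemigroup of $F$). Moreover, the divisibility poset of $N\setminus\{\infty\}$ (in which $u\le v$ iff $u\oplus w=v$ for some $w\in N\setminus\{\infty\}$) equals the Kunz poset $P$ of $F$.
   Context: Let $G$ be a finite abelian group, $m=|G|$. The group cone $\mathcal C(G)\subseteq\mathbb R^{G\setminus\{0\}}$ (coordinates $x_g$ indexed by $g\in G\setminus\{0\}$) is the set of $x$ with $x_i+x_j\ge x_{i+j}$ for all $i,j\in G\setminus\{0\}$ with $i+j\ne 0$; throughout, set $x_0:=0$. A face of $\mathcal C(G)$ is a nonempty set of the form $\{x\in\mathcal C(G): x_i+x_j=x_{i+j}\text{ for all }(i,j)\in E\}$ for some set $E$ of such index pairs. The Kunz subgroup of a face $F$ is $H=\{h\in G: x_h=0\text{ for all }x\in F\}$. It is known that $H$ is a subgroup of $G$, that whether "$x_a+x_b=x_{a+b}$ for all $x\in F$" holds depends only on the cosets $a+H,b+H$ (so $\oplus$ is well defined), and that the relation on $G/H$ having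 $\overline 0$ as unique minimal element and $\overline a\preceq\overline b$ for distinct $\overline a,\overline b$ with $a,b\in G\setminus H$ whenever $x_a+x_{b-a}=x_b$ for all $x\in F$, is a partial order, called the Kunz poset of $F$. Semigroup terminology: in a commutative semigroup $(N,+)$, a nil is an element $\infty$ with $a+\infty=\infty$ for all $a$; an element $a$ is nilpotent if $na=\infty$ for some integer $n\ge1$; $a$ is partly cancellative if $a+b=a+c\ne\infty$ implies $b=c$. $N$ is a nilsemigroup with identity if it has an identity element and every non-identity element is nilpotent; it is partly cancellative if every non-nil element is partly cancellative. *)

theory Defs
  imports Complex_Main "HOL-Algebra.Coset"
begin

text \<open>
  The abelian group is an HOL-Algebra group and hence written multiplicatively: \<open>i \<otimes> j\<close>, \<open>\<one>\<close>, \<open>inv i\<close>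
  stand for $i+j$, $0$, $-i$.
\<close>

section \<open>The group cone and its faces\<close>

definition face_pairs :: "('a, 'b) monoid_scheme \<Rightarrow> ('a \<times> 'a) set" where
  "face_pairs G = {(i, j). i \<in> carrier G - {\<one>\<^bsub>G\<^esub>} \<and> j \<in> carrier G - {\<one>\<^bsub>G\<^esub>} \<and> i \<otimes>\<^bsub>G\<^esub> j \<noteq> \<one>\<^bsub>G\<^esub>}"

text \<open>
  A point of $\mathbb R^{G\setminus\{0\}}$ is represented together with the convention $x_0 = 0$,
  as a function on all of \<open>carrier G\<close> that vanishes at \<open>\<one>\<close>; extensionality makes this
  representation unique.
\<close>

definition group_cone :: "('a, 'b) monoid_scheme \<Rightarrow> ('a \<Rightarrow> real) set" where
  "group_cone G = {x \<in> extensional (carrier G).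
     x \<one>\<^bsub>G\<^esub> = 0 \<and> (\<forall>(i, j) \<in> face_pairs G. x i + x j \<ge> x (i \<otimes>\<^bsub>G\<^esub> j))}"

definition is_face :: "('a, 'b) monoid_scheme \<Rightarrow> ('a \<Rightarrow> real) set \<Rightarrow> bool" where
  "is_face G F \<longleftrightarrow> F \<noteq> {} \<and>
     (\<exists>E \<subseteq> face_pairs G. F = {x \<in> group_cone G. \<forall>(i, j) \<in> E. x i + x j = x (i \<otimes>\<^bsub>G\<^esub> j)})"

definition kunz_subgroup :: "('a, 'b) monoid_scheme \<Rightarrow> ('a \<Rightarrow> real) set \<Rightarrow> 'a set" where
  "kunz_subgroup G F = {h \<in> carrier G. \<forall>x \<in> F. x h = 0}"

definition tight :: "('a, 'b) monoid_scheme \<Rightarrow> ('a \<Rightarrow> real) set \<Rightarrow> 'a \<Rightarrow> 'a \<Rightarrow> bool" where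
  "tight G F a b \<longleftrightarrow> (\<forall>x \<in> F. x a + x b = x (a \<otimes>\<^bsub>G\<^esub> b))"

section \<open>Kunz poset and Kunz nilsemigroup\<close>

text \<open>
  Both definitions pick arbitrary representatives of the cosets; the choice does not matter, see
  \<open>kunz_order_coset_iff\<close> and \<open>kunz_nilsemigroup_mult\<close> below.
\<close>

definition kunz_order :: "('a, 'b) monoid_scheme \<Rightarrow> ('a \<Rightarrow> real) set \<Rightarrow> ('a set \<times> 'a set) set" where
  "kunz_order G F = (let H = kunz_subgroup G F in
     {(u, v). u \<in> carrier (G Mod H) \<and> v \<in> carrier (G Mod H) \<and>
        (u = H \<or> u = v \<or>
         (u \<noteq> H \<and> v \<noteq> H \<and> (\<exists>a \<in> u. \<exists>b \<in> v. tight G F a (b \<otimes>\<^bsub>G\<^esub> inv\<^bsub>G\<^esub> a))))})"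

fun kunz_mult :: "('a, 'b) monoid_scheme \<Rightarrow> ('a \<Rightarrow> real) set \<Rightarrow>
    'a set option \<Rightarrow> 'a set option \<Rightarrow> 'a set option" where
  "kunz_mult G F (Some u) (Some v) =
     (if \<exists>a \<in> u. \<exists>b \<in> v. tight G F a b then Some (u \<otimes>\<^bsub>G Mod kunz_subgroup G F\<^esub> v) else None)"
| "kunz_mult G F None v = None"
| "kunz_mult G F u None = None"

text \<open>The element \<open>None\<close> plays the role of $\infty$.\<close>

definition kunz_nilsemigroup ::
    "('a, 'b) monoid_scheme \<Rightarrow> ('a \<Rightarrow> real) set \<Rightarrow> 'a set option monoid" where
  "kunz_nilsemigroup G F =
     \<lparr>carrier = insert None (Some ` carrier (G Mod kunz_subgroup G F)),
      mult = kunz_mult G F,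
      one = Some (kunz_subgroup G F)\<rparr>"

section \<open>Nilsemigroups\<close>

definition is_nil :: "('a, 'b) monoid_scheme \<Rightarrow> 'a \<Rightarrow> bool" where
  "is_nil N z \<longleftrightarrow> z \<in> carrier N \<and> (\<forall>a \<in> carrier N. a \<otimes>\<^bsub>N\<^esub> z = z)"

definition nilpotent_elem :: "('a, 'b) monoid_scheme \<Rightarrow> 'a \<Rightarrow> bool" where
  "nilpotent_elem N a \<longleftrightarrow> (\<exists>n::nat. n \<ge> 1 \<and> is_nil N (a [^]\<^bsub>N\<^esub> n))"

definition partly_cancellative_elem :: "('a, 'b) monoid_scheme \<Rightarrow> 'a \<Rightarrow> bool" where
  "partly_cancellative_elem N a \<longleftrightarrow>
     (\<forall>b \<in> carrier N. \<forall>c \<in> carrier N.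
        a \<otimes>\<^bsub>N\<^esub> b = a \<otimes>\<^bsub>N\<^esub> c \<and> \<not> is_nil N (a \<otimes>\<^bsub>N\<^esub> b) \<longrightarrow> b = c)"

definition nilsemigroup_with_identity :: "('a, 'b) monoid_scheme \<Rightarrow> bool" where
  "nilsemigroup_with_identity N \<longleftrightarrow>
     comm_monoid N \<and> (\<exists>z. is_nil N z) \<and> (\<forall>a \<in> carrier N - {\<one>\<^bsub>N\<^esub>}. nilpotent_elem N a)"

definition partly_cancellative :: "('a, 'b) monoid_scheme \<Rightarrow> bool" where
  "partly_cancellative N \<longleftrightarrow>
     (\<forall>a \<in> carrier N. \<not> is_nil N a \<longrightarrow> partly_cancellative_elem N a)"

definition non_nil :: "('a, 'b) monoid_scheme \<Rightarrow> 'a set" where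
  "non_nil N = {a \<in> carrier N. \<not> is_nil N a}"

definition divisibility_order :: "('a, 'b) monoid_scheme \<Rightarrow> ('a \<times> 'a) set" where
  "divisibility_order N =
     {(u, v). u \<in> non_nil N \<and> v \<in> non_nil N \<and> (\<exists>w \<in> non_nil N. u \<otimes>\<^bsub>N\<^esub> w = v)}"

section \<open>Independence of representatives\<close>

context
  fixes G (structure) and x :: "'a \<Rightarrow> real"
  assumes G: "comm_group G" and fin: "finite (carrier G)" and x: "x \<in> group_cone G"
begin

interpretation comm_group G by (fact G)

lemma cone_one: "x \<one> = 0"
  using x by (simp add: group_cone_def)

lemma cone_ineq:
  assumes "i \<in> carrier G" "j \<in> carrier G" "i \<otimes> j \<noteq> \<one>"
  shows "x (i \<otimes> j) \<le> x i + x j"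
proof (cases "i = \<one> \<or> j = \<one>")
  case True
  then show ?thesis using assms cone_one by auto
next
  case False
  then have "(i, j) \<in> face_pairs G" using assms by (auto simp: face_pairs_def)
  then show ?thesis using x by (auto simp: group_cone_def)
qed

lemma cone_inv_le:
  assumes i: "i \<in> carrier G" "i \<noteq> \<one>"
  shows "x (inv i) \<le> (real (card (carrier G)) - 1) * x i"
proof -
  let ?t = "\<lambda>j. x i + x j - x (i \<otimes> j)"
  have bij: "bij_betw (\<lambda>j. i \<otimes> j) (carrier G) (carrier G)"
    using i by (intro bij_betwI[where g = "\<lambda>j. inv i \<otimes> j"]) (auto simp: m_assoc[symmetric])
  have inv: "inv i \<in> carrier G" "inv i \<noteq> \<one>" using i by auto
  have "real (card (carrier G)) * x i = (\<Sum>j \<in> carrier G. ?t j)"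
    using sum.reindex_bij_betw[OF bij, of x] by (simp add: sum.distrib sum_subtractf)
  also have "\<dots> \<ge> (\<Sum>j \<in> {inv i}. ?t j)"
  proof (rule sum_mono2[OF fin])
    fix j assume j: "j \<in> carrier G - {inv i}"
    then have "i \<otimes> j \<noteq> \<one>" using i inv_equality[of j i] by (auto simp: m_comm)
    then show "0 \<le> ?t j" using cone_ineq[of i j] i j by auto
  qed (use inv in auto)
  finally have "x i + x (inv i) \<le> real (card (carrier G)) * x i"
    using i by (simp add: cone_one)
  then show ?thesis by (simp add: algebra_simps)
qed

lemma cone_nonneg:
  assumes i: "i \<in> carrier G" and c: "card (carrier G) \<ge> 3"
  shows "x i \<ge> 0"
proof (cases "i = \<one>")
  case True
  then show ?thesis by (simp add: cone_one)
next
  case False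
  define m where "m = real (card (carrier G)) - 1"
  have m: "m \<ge> 2" using c by (simp add: m_def)
  have a: "x (inv i) \<le> m * x i" using cone_inv_le[OF i False] by (simp add: m_def)
  have b: "x i \<le> m * x (inv i)" using cone_inv_le[of "inv i"] i False by (simp add: m_def)
  have "m * x (inv i) \<le> m * (m * x i)" using a m by (intro mult_left_mono) auto
  then have "0 \<le> (m * m - 1) * x i" using b by (simp add: algebra_simps)
  moreover have "m * m - 1 > 0" using mult_mono[of 2 m 2 m] m by simp
  ultimately show ?thesis by (simp add: zero_le_mult_iff)
qed

lemma cone_subadditive:
  assumes "i \<in> carrier G" "j \<in> carrier G" "card (carrier G) \<ge> 3"
  shows "x (i \<otimes> j) \<le> x i + x j"
  using cone_ineq[of i j] cone_nonneg[of i] cone_nonneg[of j] assms cone_one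
  by (cases "i \<otimes> j = \<one>") auto

end

context
  fixes G (structure) and F :: "('a \<Rightarrow> real) set"
  assumes G: "comm_group G" and fin: "finite (carrier G)" and F: "is_face G F"
begin

interpretation comm_group G by (fact G)

lemma face_in_cone: "x \<in> F \<Longrightarrow> x \<in> group_cone G"
  using F by (auto simp: is_face_def)

lemma kunz_subgroup_small:
  assumes c: "card (carrier G) < 3"
  shows "kunz_subgroup G F = {\<one>}"
proof -
  have two: "j = i" if "i \<in> carrier G" "j \<in> carrier G" "i \<noteq> \<one>" "j \<noteq> \<one>" for i j
  proof (rule ccontr)
    assume "j \<noteq> i"
    then have "card {\<one>, i, j} = 3" using that by auto
    moreover have "card {\<one>, i, j} \<le> card (carrier G)" using that by (intro card_mono[OF fin]) auto
    ultimately show False using c by simp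
  qed
  have "face_pairs G = {}"
  proof -
    have False if "(i, j) \<in> face_pairs G" for i j
    proof -
      have ij: "i \<in> carrier G" "j \<in> carrier G" "i \<noteq> \<one>" "j \<noteq> \<one>" "i \<otimes> j \<noteq> \<one>"
        using that by (auto simp: face_pairs_def)
      then have "i \<otimes> j = i" using two[of i "i \<otimes> j"] by auto
      then show False using ij by simp
    qed
    then show ?thesis by auto
  qed
  then have FC: "F = {x \<in> extensional (carrier G). x \<one> = 0}"
    using F by (auto simp: is_face_def group_cone_def)
  have "restrict (\<lambda>g. if g = \<one> then 0 else 1) (carrier G) \<in> F"
    unfolding FC by auto
  then have "h = \<one>" if "h \<in> kunz_subgroup G F" for h
    using that by (auto simp: kunz_subgroup_def dest!: bspec split: if_splits)
  moreover have "\<one> \<in> kunz_subgroup G F" using FC by (auto simp: kunz_subgroup_def)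
  ultimately show ?thesis by blast
qed

lemma kunz_subgroup_subgroup: "subgroup (kunz_subgroup G F) G"
proof (cases "card (carrier G) < 3")
  case True
  then show ?thesis using kunz_subgroup_small triv_subgroup by simp
next
  case False
  then have c: "card (carrier G) \<ge> 3" by simp
  note sub = cone_subadditive[OF G fin face_in_cone _ _ c]
  note nn = cone_nonneg[OF G fin face_in_cone _ c]
  show ?thesis
  proof
    show "kunz_subgroup G F \<subseteq> carrier G" by (auto simp: kunz_subgroup_def)
    show "\<one> \<in> kunz_subgroup G F"
      using cone_one[OF G fin face_in_cone] by (auto simp: kunz_subgroup_def)
  next
    fix h k assume "h \<in> kunz_subgroup G F" "k \<in> kunz_subgroup G F"
    then have hk: "h \<in> carrier G" "k \<in> carrier G" "\<And>x. x \<in> F \<Longrightarrow> x h = 0" "\<And>x. x \<in> F \<Longrightarrow> x k = 0"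
      by (auto simp: kunz_subgroup_def)
    have "x (h \<otimes> k) = 0" if "x \<in> F" for x
      using sub[OF that hk(1,2)] nn[OF that, of "h \<otimes> k"] hk(1,2) hk(3,4)[OF that] by simp
    then show "h \<otimes> k \<in> kunz_subgroup G F" using hk by (simp add: kunz_subgroup_def)
  next
    fix h assume h: "h \<in> kunz_subgroup G F"
    then have hc: "h \<in> carrier G" by (simp add: kunz_subgroup_def)
    have "x (inv h) = 0" if "x \<in> F" for x
    proof (cases "h = \<one>")
      case True
      then show ?thesis using cone_one[OF G fin face_in_cone[OF that]] by simp
    next
      case False
      have "x h = 0" using h that by (simp add: kunz_subgroup_def)
      then show ?thesis
        using cone_inv_le[OF G fin face_in_cone[OF that] hc False] nn[OF that, of "inv h"] hc
        by simp
    qed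
    then show "inv h \<in> kunz_subgroup G F" using hc by (simp add: kunz_subgroup_def)
  qed
qed

lemma face_shift:
  assumes h: "h \<in> kunz_subgroup G F" and a: "a \<in> carrier G" and x: "x \<in> F"
  shows "x (h \<otimes> a) = x a"
proof (cases "card (carrier G) < 3")
  case True
  then show ?thesis using kunz_subgroup_small h a by simp
next
  case False
  then have c: "card (carrier G) \<ge> 3" by simp
  note sub = cone_subadditive[OF G fin face_in_cone[OF x] _ _ c]
  have hc: "h \<in> carrier G" and h': "inv h \<in> kunz_subgroup G F"
    using h subgroup.m_inv_closed[OF kunz_subgroup_subgroup] by (auto simp: kunz_subgroup_def)
  have 1: "x h = 0" "x (inv h) = 0" using h h' x by (auto simp: kunz_subgroup_def)
  have "inv h \<otimes> (h \<otimes> a) = a" using hc a by (simp add: m_assoc[symmetric])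
  then show ?thesis using sub[of h a] sub[of "inv h" "h \<otimes> a"] 1 hc a by auto
qed

lemma face_coset:
  assumes "a \<in> carrier G" "a' \<in> kunz_subgroup G F #> a" "x \<in> F"
  shows "x a' = x a"
  using assms face_shift by (auto simp: r_coset_def)

lemma kunz_normal: "kunz_subgroup G F \<lhd> G"
  using kunz_subgroup_subgroup by (rule subgroup_imp_normal)

lemma coset_carrier:
  assumes "a \<in> carrier G" "a' \<in> kunz_subgroup G F #> a"
  shows "a' \<in> carrier G"
  using assms subgroup.subset[OF kunz_subgroup_subgroup] by (auto simp: r_coset_def)

lemma coset_repr:
  assumes "a \<in> carrier G" "a' \<in> kunz_subgroup G F #> a"
  shows "kunz_subgroup G F #> a' = kunz_subgroup G F #> a"
  using repr_independence[OF assms(2,1) kunz_subgroup_subgroup] by simp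

lemma tight_coset:
  assumes ab: "a \<in> carrier G" "b \<in> carrier G"
    and a': "a' \<in> kunz_subgroup G F #> a" and b': "b' \<in> kunz_subgroup G F #> b"
  shows "tight G F a' b' \<longleftrightarrow> tight G F a b"
proof -
  interpret K: normal "kunz_subgroup G F" G by (fact kunz_normal)
  have c: "a' \<in> carrier G" "b' \<in> carrier G" using coset_carrier[OF ab(1) a'] coset_carrier[OF ab(2) b'] by simp_all
  have "kunz_subgroup G F #> (a' \<otimes> b') = kunz_subgroup G F #> (a \<otimes> b)"
    by (simp only: K.rcos_sum[OF c, symmetric] K.rcos_sum[OF ab, symmetric]
        coset_repr[OF ab(1) a'] coset_repr[OF ab(2) b'])
  then have "a' \<otimes> b' \<in> kunz_subgroup G F #> (a \<otimes> b)"
    using rcos_self[OF m_closed[OF c] kunz_subgroup_subgroup] by simp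
  then have ab': "x (a' \<otimes> b') = x (a \<otimes> b)" if "x \<in> F" for x
    using face_coset[OF _ _ that] ab by blast
  have "x a' + x b' = x (a' \<otimes> b') \<longleftrightarrow> x a + x b = x (a \<otimes> b)" if "x \<in> F" for x
    unfolding ab'[OF that] face_coset[OF ab(1) a' that] face_coset[OF ab(2) b' that] ..
  then show ?thesis unfolding tight_def by (rule ball_cong[OF refl])
qed

lemma kunz_nilsemigroup_mult:
  assumes ab: "a \<in> carrier G" "b \<in> carrier G"
  shows "Some (kunz_subgroup G F #> a) \<otimes>\<^bsub>kunz_nilsemigroup G F\<^esub> Some (kunz_subgroup G F #> b) =
    (if \<forall>x \<in> F. x a + x b = x (a \<otimes> b) then Some (kunz_subgroup G F #> (a \<otimes> b)) else None)"
proof -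
  have "(\<exists>a' \<in> kunz_subgroup G F #> a. \<exists>b' \<in> kunz_subgroup G F #> b. tight G F a' b')
      \<longleftrightarrow> tight G F a b"
    using tight_coset[OF ab] rcos_self[OF ab(1) kunz_subgroup_subgroup]
      rcos_self[OF ab(2) kunz_subgroup_subgroup] by blast
  then show ?thesis
    using normal.rcos_sum[OF kunz_normal ab] by (simp add: kunz_nilsemigroup_def tight_def)
qed

lemma kunz_order_coset_iff:
  assumes ab: "a \<in> carrier G" "b \<in> carrier G"
  shows "(kunz_subgroup G F #> a, kunz_subgroup G F #> b) \<in> kunz_order G F \<longleftrightarrow>
    a \<in> kunz_subgroup G F \<or> kunz_subgroup G F #> a = kunz_subgroup G F #> b \<or>
    (a \<notin> kunz_subgroup G F \<and> b \<notin> kunz_subgroup G F \<and>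
     (\<forall>x \<in> F. x a + x (b \<otimes> inv a) = x b))"
proof -
  interpret K: normal "kunz_subgroup G F" G by (fact kunz_normal)
  let ?H = "kunz_subgroup G F"
  have H: "?H #> c = ?H \<longleftrightarrow> c \<in> ?H" if "c \<in> carrier G" for c
    using coset_join1[OF _ that kunz_subgroup_subgroup] coset_join2[OF that kunz_subgroup_subgroup]
    by blast
  have t: "tight G F a' (b' \<otimes> inv a') \<longleftrightarrow> tight G F a (b \<otimes> inv a)"
    if a': "a' \<in> ?H #> a" and b': "b' \<in> ?H #> b" for a' b'
  proof (rule tight_coset[OF ab(1) _ a'])
    have c: "a' \<in> carrier G" "b' \<in> carrier G" using coset_carrier[OF ab(1) a'] coset_carrier[OF ab(2) b'] by simp_all
    have "?H #> (b' \<otimes> inv a') = ?H #> (b \<otimes> inv a)"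
      by (simp only: K.rcos_sum[OF c(2) inv_closed[OF c(1)], symmetric]
          K.rcos_sum[OF ab(2) inv_closed[OF ab(1)], symmetric]
          K.rcos_inv[OF c(1), symmetric] K.rcos_inv[OF ab(1), symmetric]
          coset_repr[OF ab(1) a'] coset_repr[OF ab(2) b'])
    then show "b' \<otimes> inv a' \<in> ?H #> (b \<otimes> inv a)"
      using rcos_self[OF m_closed[OF c(2) inv_closed[OF c(1)]] kunz_subgroup_subgroup] by simp
  qed (use ab in auto)
  have "(\<exists>a' \<in> ?H #> a. \<exists>b' \<in> ?H #> b. tight G F a' (b' \<otimes> inv a')) \<longleftrightarrow> tight G F a (b \<otimes> inv a)"
    using t rcos_self[OF ab(1) kunz_subgroup_subgroup]
      rcos_self[OF ab(2) kunz_subgroup_subgroup] by blast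
  moreover have "a \<otimes> (b \<otimes> inv a) = b"
    using ab by (simp add: m_lcomm[of a b])
  ultimately show ?thesis
    using ab by (simp add: kunz_order_def Let_def carrier_FactGroup tight_def H)
qed

lemma is_nil_kunz_nilsemigroup_iff: "is_nil (kunz_nilsemigroup G F) z \<longleftrightarrow> z = None"
proof
  have N: "u \<otimes>\<^bsub>kunz_nilsemigroup G F\<^esub> None = None" "None \<otimes>\<^bsub>kunz_nilsemigroup G F\<^esub> u = None" for u
    by (cases u; simp add: kunz_nilsemigroup_def)+
  show "is_nil (kunz_nilsemigroup G F) z" if "z = None"
    using that by (simp add: is_nil_def N) (simp add: kunz_nilsemigroup_def)
  show "z = None" if "is_nil (kunz_nilsemigroup G F) z"
  proof -
    have "None \<in> carrier (kunz_nilsemigroup G F)" by (simp add: kunz_nilsemigroup_def)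
    then have "None \<otimes>\<^bsub>kunz_nilsemigroup G F\<^esub> z = z" using that by (simp add: is_nil_def)
    then show ?thesis by (simp only: N)
  qed
qed

end

end

theory Submission
  imports Defs "HOL-Algebra.Multiplicative_Group"
begin

text \<open>
  Off the degenerate case of at most two group elements every \<open>x \<in> F\<close> is subadditive, and then both
  bracketings of a threefold product are different from \<open>\<infinity>\<close> exactly if
  \<open>x a + x b + x c = x (a \<otimes> b \<otimes> c)\<close> on \<open>F\<close>; this gives associativity. If the \<open>n\<close>-th power of
  the coset of \<open>a\<close> is not \<open>\<infinity>\<close>, then \<open>n * x a = x (a [^] n)\<close> on \<open>F\<close>; taking \<open>n = |G|\<close> forces \<open>x a = 0\<close>, so
  every coset other than \<open>H\<close> is nilpotent. Cancellation is inherited from \<open>G / H\<close>. Nilpotency alone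
  makes divisibility antisymmetric and leaves no units but the identity; the latter shows that
  divisibility agrees with the Kunz order at \<open>H\<close>.
\<close>

section \<open>Divisibility in nilsemigroups\<close>

lemma (in comm_monoid) is_nil_mult:
  assumes "is_nil G z" "a \<in> carrier G"
  shows "is_nil G (a \<otimes> z)" "is_nil G (z \<otimes> a)"
  using assms by (auto simp: is_nil_def m_comm[of z a])

text \<open>Iteration gives \<open>u = u \<otimes> (w [^] n \<otimes> w' [^] n)\<close> for every
  \<open>n\<close>, and the right side is nil once \<open>w [^] n\<close> is. Antisymmetry uses this
  for arbitrary \<open>u\<close>; for \<open>u = \<one>\<close> it says that a unit is the
  identity.\<close>

lemma nilsemigroup_fixed_point_factor:
  fixes N (structure)
  assumes N: "nilsemigroup_with_identity N"
    and u: "u \<in> carrier N" "\<not> is_nil N u"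
    and w: "w \<in> carrier N" "w' \<in> carrier N"
    and eq: "u \<otimes> (w \<otimes> w') = u"
  shows "w = \<one>"
proof (rule ccontr)
  interpret comm_monoid N using N by (simp add: nilsemigroup_with_identity_def)
  assume "w \<noteq> \<one>"
  then obtain n :: nat where n: "is_nil N (w [^] n)"
    using N w by (auto simp: nilsemigroup_with_identity_def nilpotent_elem_def)
  have "u \<otimes> (w \<otimes> w') [^] k = u" for k :: nat
  proof (induction k)
    case (Suc k)
    have "u \<otimes> (w \<otimes> w') [^] Suc k = u \<otimes> (w \<otimes> w') [^] k \<otimes> (w \<otimes> w')"
      using u w by (simp add: m_assoc)
    then show ?case using Suc eq by simp
  qed (use u in simp)
  then have "u = u \<otimes> (w [^] n \<otimes> w' [^] n)"
    using w by (simp add: pow_mult_distrib m_comm)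
  moreover have "is_nil N (u \<otimes> (w [^] n \<otimes> w' [^] n))"
    using n u w by (intro is_nil_mult) auto
  ultimately show False using u by simp
qed

lemma divisibility_order_partial_order:
  fixes N (structure)
  assumes N: "nilsemigroup_with_identity N"
  shows "partial_order_on (non_nil N) (divisibility_order N)"
proof -
  interpret comm_monoid N using N by (simp add: nilsemigroup_with_identity_def)
  \<comment> \<open>A nil \<one> would make \<open>u \<otimes> \<one> = u\<close> nil; reflexivity
    needs \<one> as a non-nil cofactor.\<close>
  have one: "\<one> \<in> non_nil N" if "u \<in> non_nil N" for u
    using that is_nil_mult(1)[of \<one> u] by (auto simp: non_nil_def)
  have refl: "(u, u) \<in> divisibility_order N" if "u \<in> non_nil N" for u
    using that one[OF that] by (auto simp: divisibility_order_def non_nil_def intro!: bexI[of _ \<one>])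
  have trans: "(u, t) \<in> divisibility_order N"
    if uvt: "(u, v) \<in> divisibility_order N" "(v, t) \<in> divisibility_order N" for u v t
  proof -
    obtain w w' where w: "w \<in> non_nil N" "w' \<in> non_nil N" "u \<otimes> w = v" "v \<otimes> w' = t"
      and ut: "u \<in> non_nil N" "t \<in> non_nil N"
      using uvt by (auto simp: divisibility_order_def)
    then have eq: "u \<otimes> (w \<otimes> w') = t" by (auto simp: non_nil_def m_assoc)
    \<comment> \<open>If this product were nil, its multiple \<open>t\<close> would be nil as
      well.\<close>
    then have "w \<otimes> w' \<in> non_nil N" using w ut is_nil_mult(1)[of "w \<otimes> w'" u] by (auto simp: non_nil_def)
    then show ?thesis using eq ut by (auto simp: divisibility_order_def)
  qed
  have antisym: "u = v"
    if uv: "(u, v) \<in> divisibility_order N" "(v, u) \<in> divisibility_order N" for u v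
  proof -
    obtain w w' where w: "w \<in> carrier N" "w' \<in> carrier N" "u \<otimes> w = v" "v \<otimes> w' = u"
      and u: "u \<in> carrier N" "\<not> is_nil N u"
      using uv by (auto simp: divisibility_order_def non_nil_def)
    then have "u \<otimes> (w \<otimes> w') = u" by (auto simp: m_assoc)
    then have "w = \<one>" using nilsemigroup_fixed_point_factor[OF N u w(1,2)] by simp
    then show ?thesis using w u by simp
  qed
  have "divisibility_order N \<subseteq> non_nil N \<times> non_nil N" by (auto simp: divisibility_order_def)
  then show ?thesis
    unfolding partial_order_on_def preorder_on_def refl_on_def
    using refl by (auto intro!: transI antisymI intro: trans antisym)
qed

section \<open>The Kunz nilsemigroup\<close>

context
  fixes G (structure) and F :: "('a \<Rightarrow> real) set"
  assumes G: "comm_group G" and fin: "finite (carrier G)" and F: "is_face G F"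
begin

interpretation comm_group G by (fact G)

private abbreviation (input) "H \<equiv> kunz_subgroup G F"
private abbreviation (input) "N \<equiv> kunz_nilsemigroup G F"

interpretation K: normal H G by (fact kunz_normal[OF G fin F])

section \<open>Tight pairs\<close>

lemma face_one: "x \<in> F \<Longrightarrow> x \<one> = 0"
  by (rule cone_one[OF G fin face_in_cone[OF G fin F]])

text \<open>In order two the cone carries no inequalities, so \<open>x\<close> may be negative and
  subadditivity fails at \<open>a \<otimes> a = \<one>\<close>. A tight pair \<open>(a, a)\<close>
  would give \<open>2 * x a = 0\<close> on \<open>F\<close>, putting \<open>a\<close> into
  \<open>H\<close>, which is trivial here.\<close>

lemma tight_small:
  assumes c: "card (carrier G) < 3" and ab: "a \<in> carrier G" "b \<in> carrier G" and t: "tight G F a b"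
  shows "a = \<one> \<or> b = \<one>"
proof (rule ccontr)
  assume n: "\<not> (a = \<one> \<or> b = \<one>)"
  have two: "j = a" if "j \<in> carrier G" "j \<noteq> \<one>" for j
  proof (rule ccontr)
    assume "j \<noteq> a"
    then have "card {\<one>, a, j} = 3" using that n by auto
    moreover have "card {\<one>, a, j} \<le> card (carrier G)" using that ab by (intro card_mono[OF fin]) auto
    ultimately show False using c by simp
  qed
  have ba: "b = a" using two ab n by blast
  have "a \<otimes> a \<noteq> a" using ab n by simp
  then have aa: "a \<otimes> a = \<one>" using two[of "a \<otimes> a"] ab by auto
  have "x a = 0" if "x \<in> F" for x
  proof -
    have "x a + x a = x (a \<otimes> a)" using t that unfolding tight_def ba by blast
    then show ?thesis using face_one[OF that] by (simp add: aa)
  qed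
  then have "a \<in> H" using ab unfolding kunz_subgroup_def by blast
  then show False using kunz_subgroup_small[OF G fin F c] n by simp
qed

lemma tight_one [simp]:
  assumes "a \<in> carrier G"
  shows "tight G F \<one> a" "tight G F a \<one>"
  unfolding tight_def using assms by (intro ballI; simp add: face_one)+

lemma tight_commute:
  assumes "a \<in> carrier G" "b \<in> carrier G"
  shows "tight G F a b \<longleftrightarrow> tight G F b a"
  unfolding tight_def m_comm[OF assms] by (intro ball_cong) auto

text \<open>Each bracketing gives a chain of two subadditivity estimates from
  \<open>x (a \<otimes> b \<otimes> c)\<close> up to \<open>x a + x b + x c\<close>. Each
  conjunction says that its chain consists of equalities, that is, that the common ends
  agree.\<close>

lemma tight_assoc:
  assumes abc: "a \<in> carrier G" "b \<in> carrier G" "c \<in> carrier G"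
  shows "tight G F a b \<and> tight G F (a \<otimes> b) c \<longleftrightarrow> tight G F b c \<and> tight G F a (b \<otimes> c)"
proof (cases "card (carrier G) < 3")
  case True
  note small = tight_small[OF True]
  show ?thesis
    \<comment> \<open>If none of the three factors is \<one>, both sides fail; otherwise both reduce
      to tightness of the other two.\<close>
    using small[of a b] small[of b c] small[of "a \<otimes> b" c] small[of a "b \<otimes> c"] abc by auto
next
  case False
  have "x a + x b = x (a \<otimes> b) \<and> x (a \<otimes> b) + x c = x (a \<otimes> b \<otimes> c)
    \<longleftrightarrow> x b + x c = x (b \<otimes> c) \<and> x a + x (b \<otimes> c) = x (a \<otimes> (b \<otimes> c))" if "x \<in> F" for x
  proof -
    note sub = cone_subadditive[OF G fin face_in_cone[OF G fin F that]]
    show ?thesis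
      using sub[of a b] sub[of b c] sub[of "a \<otimes> b" c] sub[of a "b \<otimes> c"] False abc m_assoc[OF abc]
      by auto
  qed
  then show ?thesis unfolding tight_def by blast
qed

section \<open>The commutative monoid structure\<close>

lemma kunz_mult_coset:
  assumes "a \<in> carrier G" "b \<in> carrier G"
  shows "Some (H #> a) \<otimes>\<^bsub>N\<^esub> Some (H #> b) = (if tight G F a b then Some (H #> (a \<otimes> b)) else None)"
  using kunz_nilsemigroup_mult[OF G fin F assms] by (simp add: tight_def)

lemma kunz_mult_None:
  "u \<otimes>\<^bsub>N\<^esub> None = None" "None \<otimes>\<^bsub>N\<^esub> u = None"
  by (cases u; simp add: kunz_nilsemigroup_def)+

lemma kunz_carrier: "carrier N = insert None ((\<lambda>a. Some (H #> a)) ` carrier G)"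
  by (auto simp: kunz_nilsemigroup_def carrier_FactGroup)

text \<open>Writing \<open>H\<close> as the coset of \<one> brings products with the identity under
  \<open>kunz_mult_coset\<close>.\<close>

lemma kunz_one: "\<one>\<^bsub>N\<^esub> = Some (H #> \<one>)"
  by (simp add: kunz_nilsemigroup_def coset_mult_one K.subset)

lemma kunz_carrier_cases [consumes 1, case_names nil coset]:
  assumes "u \<in> carrier N"
  obtains "u = None" | a where "a \<in> carrier G" "u = Some (H #> a)"
  using assms by (auto simp: kunz_carrier)

lemma kunz_mult_assoc:
  assumes abc: "a \<in> carrier G" "b \<in> carrier G" "c \<in> carrier G"
  shows "Some (H #> a) \<otimes>\<^bsub>N\<^esub> Some (H #> b) \<otimes>\<^bsub>N\<^esub> Some (H #> c)
    = Some (H #> a) \<otimes>\<^bsub>N\<^esub> (Some (H #> b) \<otimes>\<^bsub>N\<^esub> Some (H #> c))"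
  using tight_assoc[OF abc] abc
  \<comment> \<open>The case splits decide which inner products are \<open>None\<close>;
    \<open>tight_assoc\<close> then matches the outer ones.\<close>
  by (cases "tight G F a b"; cases "tight G F b c")
    (auto simp: kunz_mult_coset kunz_mult_None m_assoc)

lemma kunz_comm_monoid: "comm_monoid N"
proof (rule comm_monoidI)
  fix u v assume u: "u \<in> carrier N" and v: "v \<in> carrier N"
  show "u \<otimes>\<^bsub>N\<^esub> v \<in> carrier N"
    using u v by (auto simp: kunz_carrier kunz_mult_None kunz_mult_coset)
  show "u \<otimes>\<^bsub>N\<^esub> v = v \<otimes>\<^bsub>N\<^esub> u"
    using u v by (auto simp: kunz_carrier kunz_mult_None kunz_mult_coset tight_commute m_comm)
  fix w assume "w \<in> carrier N"
  then show "u \<otimes>\<^bsub>N\<^esub> v \<otimes>\<^bsub>N\<^esub> w = u \<otimes>\<^bsub>N\<^esub> (v \<otimes>\<^bsub>N\<^esub> w)"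
    using u v
    by (elim kunz_carrier_cases) (simp_all only: kunz_mult_None kunz_mult_assoc)
next
  show "\<one>\<^bsub>N\<^esub> \<in> carrier N" by (auto simp: kunz_one kunz_carrier)
  show "\<one>\<^bsub>N\<^esub> \<otimes>\<^bsub>N\<^esub> u = u" if "u \<in> carrier N" for u
    using that by (auto simp: kunz_carrier kunz_mult_None kunz_mult_coset kunz_one)
qed

section \<open>Powers and nilpotency\<close>

lemma kunz_pow:
  assumes a: "a \<in> carrier G" and v: "Some (H #> a) [^]\<^bsub>N\<^esub> (n::nat) = Some v"
  shows "v = H #> (a [^] n) \<and> (\<forall>x \<in> F. x (a [^] n) = real n * x a)"
  using v
proof (induction n arbitrary: v)
  case 0
  then have "v = H #> \<one>" by (simp add: kunz_one)
  moreover have "\<forall>x \<in> F. x (a [^] (0::nat)) = real 0 * x a" by (intro ballI) (simp add: face_one)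
  ultimately show ?case by simp
next
  case (Suc n)
  show ?case
  proof (cases "Some (H #> a) [^]\<^bsub>N\<^esub> n")
    case None
    then show ?thesis using Suc.prems by (simp add: kunz_mult_None)
  next
    case (Some w)
    have w: "w = H #> (a [^] n)" "\<And>x. x \<in> F \<Longrightarrow> x (a [^] n) = real n * x a"
      using Suc.IH[OF Some] by auto
    \<comment> \<open>This product is not \<open>None\<close>, so the pair is tight and
      \<open>x\<close> adds along it.\<close>
    have "Some (H #> (a [^] n)) \<otimes>\<^bsub>N\<^esub> Some (H #> a) = Some v"
      using Suc.prems Some w(1) by simp
    then have "tight G F (a [^] n) a" "v = H #> (a [^] n \<otimes> a)"
      using a by (auto simp: kunz_mult_coset split: if_splits)
    moreover have "x (a [^] n \<otimes> a) = real (Suc n) * x a" if "tight G F (a [^] n) a" "x \<in> F" for x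
    proof -
      have "x (a [^] n) + x a = x (a [^] n \<otimes> a)" using that unfolding tight_def by blast
      then show ?thesis using w(2)[OF that(2)] by (simp add: algebra_simps)
    qed
    ultimately show ?thesis by simp
  qed
qed

lemma coset_eq_one_iff:
  assumes "a \<in> carrier G"
  shows "H #> a = H #> \<one> \<longleftrightarrow> a \<in> H"
  using coset_join1[OF _ assms K.subgroup_axioms] coset_join2[OF assms K.subgroup_axioms] K.subset
  by (auto simp: coset_mult_one)

lemma kunz_nilpotent:
  assumes u: "u \<in> carrier N" "u \<noteq> \<one>\<^bsub>N\<^esub>"
  shows "nilpotent_elem N u"
  using u(1)
proof (cases rule: kunz_carrier_cases)
  case nil
  then have "is_nil N (u [^]\<^bsub>N\<^esub> (1::nat))"
    unfolding is_nil_kunz_nilsemigroup_iff[OF G fin F] by (simp add: kunz_mult_None)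
  then show ?thesis unfolding nilpotent_elem_def by blast
next
  case (coset a)
  \<comment> \<open>Positivity serves twice: it admits the group order as exponent in
    \<open>nilpotent_elem\<close>, and it lets the factor be cancelled when
    \<open>card (carrier G) * x a = 0\<close>.\<close>
  have pos: "card (carrier G) \<ge> 1" using fin order_gt_0_iff_finite by (simp add: order_def Suc_le_eq)
  have "u [^]\<^bsub>N\<^esub> card (carrier G) = None"
  proof (rule ccontr)
    assume "u [^]\<^bsub>N\<^esub> card (carrier G) \<noteq> None"
    then obtain v where "Some (H #> a) [^]\<^bsub>N\<^esub> card (carrier G) = Some v"
      using coset by auto
    then have pow: "x (a [^] card (carrier G)) = real (card (carrier G)) * x a" if "x \<in> F" for x
      using kunz_pow[OF coset(1)] that by blast
    have "x a = 0" if "x \<in> F" for x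
      using pow[OF that] pow_order_eq_1[OF coset(1)] face_one[OF that] pos by (simp add: order_def)
    then have "a \<in> H" using coset unfolding kunz_subgroup_def by blast
    then show False using u(2) coset coset_eq_one_iff by (simp add: kunz_one)
  qed
  then show ?thesis
    using pos is_nil_kunz_nilsemigroup_iff[OF G fin F] by (auto simp: nilpotent_elem_def)
qed

lemma kunz_nilsemigroup_with_identity: "nilsemigroup_with_identity N"
  using kunz_comm_monoid kunz_nilpotent is_nil_kunz_nilsemigroup_iff[OF G fin F]
  by (auto simp: nilsemigroup_with_identity_def)

section \<open>Partial cancellation\<close>

lemma coset_mult_eq_iff:
  assumes abc: "a \<in> carrier G" "b \<in> carrier G" "c \<in> carrier G"
  shows "H #> (a \<otimes> b) = H #> (a \<otimes> c) \<longleftrightarrow> H #> b = H #> c"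
proof -
  interpret Q: group "G Mod H" by (rule K.factorgroup_is_group)
  have "H #> g \<in> carrier (G Mod H)" if "g \<in> carrier G" for g
    using that by (auto simp: carrier_FactGroup)
  then show ?thesis
    using Q.Units_l_cancel[of "H #> a" "H #> b" "H #> c"] abc by (simp add: Q.Units_eq K.rcos_sum)
qed

lemma kunz_partly_cancellative: "partly_cancellative N"
proof -
  \<comment> \<open>A common product other than \<open>None\<close> makes both pairs tight, which
    leaves an equation of cosets to be cancelled in \<open>G Mod H\<close>.\<close>
  have cancel: "v = w"
    if "u \<in> carrier N" "v \<in> carrier N" "w \<in> carrier N" "u \<otimes>\<^bsub>N\<^esub> v = u \<otimes>\<^bsub>N\<^esub> w" "u \<otimes>\<^bsub>N\<^esub> v \<noteq> None" for u v w
    using that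
    by (auto simp: kunz_carrier kunz_mult_None kunz_mult_coset coset_mult_eq_iff split: if_splits)
  show ?thesis
    unfolding partly_cancellative_def partly_cancellative_elem_def
      is_nil_kunz_nilsemigroup_iff[OF G fin F]
    by (intro ballI impI; elim conjE) (rule cancel)
qed

section \<open>Divisibility and the Kunz order\<close>

lemma kunz_non_nil: "non_nil N = Some ` carrier (G Mod H)"
  unfolding non_nil_def is_nil_kunz_nilsemigroup_iff[OF G fin F]
  by (auto simp: kunz_carrier carrier_FactGroup)

text \<open>Cancellation in \<open>G Mod H\<close> leaves only the coset of
  \<open>b \<otimes> inv a\<close> as a possible cofactor, so the existential quantifier collapses
  to one tightness condition.\<close>

lemma kunz_divides_iff:
  assumes ab: "a \<in> carrier G" "b \<in> carrier G"
  shows "(Some (H #> a), Some (H #> b)) \<in> divisibility_order N \<longleftrightarrow> tight G F a (b \<otimes> inv a)"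
    (is "?L \<longleftrightarrow> ?R")
proof -
  have eq: "a \<otimes> (b \<otimes> inv a) = b" using ab by (simp add: m_lcomm[of a b])
  have "?L \<longleftrightarrow> (\<exists>c \<in> carrier G. Some (H #> a) \<otimes>\<^bsub>N\<^esub> Some (H #> c) = Some (H #> b))"
    using ab by (auto simp: divisibility_order_def kunz_non_nil carrier_FactGroup)
  also have "\<dots> \<longleftrightarrow> (\<exists>c \<in> carrier G. tight G F a c \<and> H #> (a \<otimes> c) = H #> b)"
    using ab by (auto simp: kunz_mult_coset split: if_splits)
  also have "\<dots> \<longleftrightarrow> ?R"
  proof
    assume "\<exists>c \<in> carrier G. tight G F a c \<and> H #> (a \<otimes> c) = H #> b"
    then obtain c where c: "c \<in> carrier G" "tight G F a c" "H #> (a \<otimes> c) = H #> b" by blast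
    then have "H #> c = H #> (b \<otimes> inv a)"
      using coset_mult_eq_iff[OF ab(1) c(1), of "b \<otimes> inv a"] ab eq by simp
    then have "c \<in> H #> (b \<otimes> inv a)" using rcos_self[OF c(1) K.subgroup_axioms] by simp
    then show ?R
      using tight_coset[OF G fin F ab(1) _ rcos_self[OF ab(1) K.subgroup_axioms], of "b \<otimes> inv a" c]
        ab c(2) by simp
  next
    assume ?R
    then show "\<exists>c \<in> carrier G. tight G F a c \<and> H #> (a \<otimes> c) = H #> b"
      using ab eq by (intro bexI[of _ "b \<otimes> inv a"]) auto
  qed
  finally show ?thesis .
qed

text \<open>The Kunz order has separate clauses for \<open>H\<close> and for equal cosets, whereas
  divisibility is a single tightness condition. That condition holds where the clauses grant the
  relation outright (\<open>refl\<close>, \<open>bottom\<close>) and fails where \<open>b\<close>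
  lies in \<open>H\<close> but \<open>a\<close> does not (\<open>minimal\<close>).\<close>

lemma kunz_order_iff_divides:
  assumes ab: "a \<in> carrier G" "b \<in> carrier G"
  shows "(H #> a, H #> b) \<in> kunz_order G F \<longleftrightarrow> (Some (H #> a), Some (H #> b)) \<in> divisibility_order N"
proof -
  have eq: "a \<otimes> (b \<otimes> inv a) = b" using ab by (simp add: m_lcomm[of a b])
  have tight_eq: "(\<forall>x \<in> F. x a + x (b \<otimes> inv a) = x b) \<longleftrightarrow> tight G F a (b \<otimes> inv a)"
    unfolding tight_def eq ..
  \<comment> \<open>Divisibility sees only cosets, so \<open>a\<close> may be replaced by
    \<open>b\<close>, whose cofactor is \<one>.\<close>
  have refl: "tight G F a (b \<otimes> inv a)" if "H #> a = H #> b"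
  proof -
    have "(Some (H #> b), Some (H #> b)) \<in> divisibility_order N"
      using kunz_divides_iff[OF ab(2) ab(2)] ab by simp
    then show ?thesis using kunz_divides_iff[OF ab] that by simp
  qed
  have bottom: "tight G F a (b \<otimes> inv a)" if "a \<in> H"
    unfolding tight_def
  proof
    fix x assume x: "x \<in> F"
    have "x a = 0" using that x unfolding kunz_subgroup_def by blast
    then show "x a + x (b \<otimes> inv a) = x (a \<otimes> (b \<otimes> inv a))"
      using face_shift[OF G fin F that _ x, of "b \<otimes> inv a"] ab by simp
  qed
  \<comment> \<open>The cosets of \<open>a\<close> and \<open>b \<otimes> inv a\<close> multiply to
    the identity of \<open>N\<close>, and a nilsemigroup has no further units.\<close>
  have minimal: "a \<in> H" if t: "tight G F a (b \<otimes> inv a)" and b: "b \<in> H"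
  proof -
    interpret M: comm_monoid N by (rule kunz_comm_monoid)
    let ?u = "Some (H #> a)" and ?w = "Some (H #> (b \<otimes> inv a))"
    have uw: "?u \<in> carrier N" "?w \<in> carrier N" using ab by (auto simp: kunz_carrier)
    have "?u \<otimes>\<^bsub>N\<^esub> ?w = Some (H #> b)"
      using t ab eq by (simp add: kunz_mult_coset)
    also have "\<dots> = \<one>\<^bsub>N\<^esub>"
      using b coset_eq_one_iff[OF ab(2)] by (simp add: kunz_one)
    finally have "\<one>\<^bsub>N\<^esub> \<otimes>\<^bsub>N\<^esub> (?u \<otimes>\<^bsub>N\<^esub> ?w) = \<one>\<^bsub>N\<^esub>"
      by simp
    moreover have "\<not> is_nil N \<one>\<^bsub>N\<^esub>"
      unfolding is_nil_kunz_nilsemigroup_iff[OF G fin F] kunz_one by simp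
    ultimately have "?u = \<one>\<^bsub>N\<^esub>"
      using nilsemigroup_fixed_point_factor[OF kunz_nilsemigroup_with_identity M.one_closed _ uw]
      by blast
    then show ?thesis using ab by (simp add: kunz_one coset_eq_one_iff)
  qed
  show ?thesis
    unfolding kunz_order_coset_iff[OF G fin F ab] kunz_divides_iff[OF ab] tight_eq
    using refl bottom minimal by argo
qed

text \<open>Cosets sit inside \<open>N\<close> through \<open>Some\<close>, so the two orders are
  equal up to this embedding and can be compared on representatives.\<close>

lemma divisibility_order_kunz: "divisibility_order N = map_prod Some Some ` kunz_order G F"
proof (intro Set.set_eqI iffI)
  fix p assume p: "p \<in> divisibility_order N"
  then obtain a b where ab: "a \<in> carrier G" "b \<in> carrier G" and eq: "p = (Some (H #> a), Some (H #> b))"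
    by (auto simp: divisibility_order_def kunz_non_nil carrier_FactGroup)
  then have "(H #> a, H #> b) \<in> kunz_order G F" using p kunz_order_iff_divides by simp
  then show "p \<in> map_prod Some Some ` kunz_order G F" by (auto simp: eq intro!: rev_image_eqI)
next
  fix p assume "p \<in> map_prod Some Some ` kunz_order G F"
  then obtain u v where uv: "(u, v) \<in> kunz_order G F" and p: "p = (Some u, Some v)" by auto
  then obtain a b where "a \<in> carrier G" "b \<in> carrier G" "u = H #> a" "v = H #> b"
    by (auto simp: kunz_order_def Let_def carrier_FactGroup)
  then show "p \<in> divisibility_order N" using uv p kunz_order_iff_divides by simp
qed

end

theorem theorem3p3:
  fixes G :: "('a, 'b) monoid_scheme" and F :: "('a \<Rightarrow> real) set"
  assumes "comm_group G" and "finite (carrier G)" and "is_face G F"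
  shows "nilsemigroup_with_identity (kunz_nilsemigroup G F)
    \<and> partly_cancellative (kunz_nilsemigroup G F)
    \<and> partial_order_on (non_nil (kunz_nilsemigroup G F)) (divisibility_order (kunz_nilsemigroup G F))
    \<and> non_nil (kunz_nilsemigroup G F) = Some ` carrier (G Mod kunz_subgroup G F)
    \<and> divisibility_order (kunz_nilsemigroup G F) = map_prod Some Some ` kunz_order G F"
  by (intro conjI kunz_nilsemigroup_with_identity[OF assms] kunz_partly_cancellative[OF assms]
      divisibility_order_partial_order[OF kunz_nilsemigroup_with_identity[OF assms]]
      kunz_non_nil[OF assms] divisibility_order_kunz[OF assms])

end
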